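(* Let $q$ be a prime power. The maximum size of a substrongly orthogonal set of sudoku solutions of order $q^2$ is $q-1$, and this maximum is achieved.
   Context: A sudoku solution of order $n^2$ is an $n^2\times n^2$ array with entries in $\{0,\dots,n^2-1\}$ in which every symbol occurs exactly once in each row, column and canonical $n\times n$ subsquare. Rows/columns are numbered from $0$; large row $x_1$ is the subarray of rows $x_1n,\dots,x_1n+n-1$, large column $x_3$ the subarray of columns $x_3n,\dots,x_3n+n-1$. Two arrays of the same shape with symbol sets $A$, $B$ are orthogonal if upon superimposition every ordered pair in $A\times B$ appears exactly once (the number of cells equals $|A||B|$ in all uses). Each symbol $x=b_nn+b_1$ ($b_n,b_1\in\{0,\dots,n-1\}$) has radix digit $b_n$. The radix solution $R(M)$ records at each location the radix digit of the symbol of $M$; the composite solution $N_{ij}$ of $M_i,M_j$ has at each location the symbol $n\,r_i+r_j$, where $r_i,r_j$ are the entries of $R(M_i),R(M_j)$ there. A set $\{M_1,\dots,M_m\}$ of mutually orthogonal sudoku solutions of order $n^2$ is substrongly orthogonal if (i) every canonical $n\times n$ subsquare of each $R(M_i)$ is a Latin square, and (ii) for every ordered pair of distinct indices $i,j$: (a) $N_{ij}$ is a sudoku solution, (b) each large row of $R(M_i)$ is orthogonal to the corresponding large row of $M_j$, and (c) each large column of $R(M_i)$ is orthogonal to the corresponding large column of $M_j$. *)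

theory Defs
  imports Main "HOL-Number_Theory.Prime_Powers"
begin

type_synonym array = "nat \<Rightarrow> nat \<Rightarrow> nat"

definition orth :: "(nat \<times> nat) set \<Rightarrow> nat set \<Rightarrow> nat set \<Rightarrow> array \<Rightarrow> array \<Rightarrow> bool" where
  "orth C X Y f g \<longleftrightarrow> bij_betw (\<lambda>(r, c). (f r c, g r c)) C (X \<times> Y)"

definition sudoku :: "nat \<Rightarrow> array \<Rightarrow> bool" where
  "sudoku n A \<longleftrightarrow>
     (\<forall>r<n^2. bij_betw (\<lambda>c. A r c) {0..<n^2} {0..<n^2}) \<and>
     (\<forall>c<n^2. bij_betw (\<lambda>r. A r c) {0..<n^2} {0..<n^2}) \<and>
     (\<forall>a<n. \<forall>b<n. bij_betw (\<lambda>(r, c). A (a*n + r) (b*n + c))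
                              ({0..<n} \<times> {0..<n}) {0..<n^2})"

definition grid :: "nat \<Rightarrow> (nat \<times> nat) set" where
  "grid n = {0..<n^2} \<times> {0..<n^2}"

text \<open>Radix solution: radix digit b_n of the symbol x = b_n n + b_1.\<close>
definition radix :: "nat \<Rightarrow> array \<Rightarrow> array" where
  "radix n M = (\<lambda>r c. M r c div n)"

definition composite :: "nat \<Rightarrow> array \<Rightarrow> array \<Rightarrow> array" where
  "composite n Mi Mj = (\<lambda>r c. n * radix n Mi r c + radix n Mj r c)"

definition mutually_orthogonal_sudoku :: "nat \<Rightarrow> nat \<Rightarrow> (nat \<Rightarrow> array) \<Rightarrow> bool" where
  "mutually_orthogonal_sudoku n m M \<longleftrightarrow>
     (\<forall>i<m. sudoku n (M i)) \<and>
     (\<forall>i<m. \<forall>j<m. i \<noteq> j \<longrightarrow> orth (grid n) {0..<n^2} {0..<n^2} (M i) (M j))"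

definition subsquares_latin :: "nat \<Rightarrow> array \<Rightarrow> bool" where
  "subsquares_latin n A \<longleftrightarrow>
     (\<forall>a<n. \<forall>b<n.
        (\<forall>r<n. bij_betw (\<lambda>c. A (a*n + r) (b*n + c)) {0..<n} {0..<n}) \<and>
        (\<forall>c<n. bij_betw (\<lambda>r. A (a*n + r) (b*n + c)) {0..<n} {0..<n}))"

definition large_row :: "nat \<Rightarrow> nat \<Rightarrow> (nat \<times> nat) set" where
  "large_row n x1 = {x1*n..<x1*n + n} \<times> {0..<n^2}"

definition large_col :: "nat \<Rightarrow> nat \<Rightarrow> (nat \<times> nat) set" where
  "large_col n x3 = {0..<n^2} \<times> {x3*n..<x3*n + n}"

definition substrongly_orthogonal :: "nat \<Rightarrow> nat \<Rightarrow> (nat \<Rightarrow> array) \<Rightarrow> bool" where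
  "substrongly_orthogonal n m M \<longleftrightarrow>
     mutually_orthogonal_sudoku n m M \<and>
     (\<forall>i<m. subsquares_latin n (radix n (M i))) \<and>
     (\<forall>i<m. \<forall>j<m. i \<noteq> j \<longrightarrow>
        sudoku n (composite n (M i) (M j)) \<and>
        (\<forall>x1<n. orth (large_row n x1) {0..<n} {0..<n^2} (radix n (M i)) (M j)) \<and>
        (\<forall>x3<n. orth (large_col n x3) {0..<n} {0..<n^2} (radix n (M i)) (M j)))"

end

theory Submission
  imports Defs "HOL-Computational_Algebra.Polynomial_Factorial"
begin

text \<open>
  \<^bold>\<open>Upper bound.\<close> By the composite condition the top left subsquares of the radix solutions are
  mutually orthogonal Latin squares of order q. The entry of the i-th one in position (1, 0) occurs
  in row 0 in some column other than 0, and by orthogonality these columns are distinct for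
  distinct i.

  \<^bold>\<open>Construction.\<close> Index rows by (x1, x2) and columns by (x3, x4) over the field with q elements,
  and read a cell as the cubic f = x1 + x2 Y + x4 Y^2 + x3 Y^3. For each nonzero l put the symbol
  with digits f(l), f'(l) into the cell. These pairs of functionals span the tangent lines of the
  twisted cubic, and every orthogonality requirement becomes an instance of Hermite interpolation
  at two points.

  \<^bold>\<open>The field.\<close> A field whose order is a variable is not a type, so it is represented by congruence
  modulo a prime ideal of Z[X], which keeps type class algebra available. The ideal contains the
  characteristic p and a prime divisor of X^(q-1) - 1 that vanishes at a primitive root of unity;
  then 0 and the powers of X are a transversal of the residue classes.
\<close>

subsection \<open>Prime ideals\<close>

locale ring_ideal =
  fixes I :: "'a :: comm_ring_1 set"
  assumes zero_mem: "0 \<in> I"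
    and add_mem: "a \<in> I \<Longrightarrow> b \<in> I \<Longrightarrow> a + b \<in> I"
    and mult_mem: "a \<in> I \<Longrightarrow> r * a \<in> I"
begin

lemma mult_mem': "a \<in> I \<Longrightarrow> a * r \<in> I"
  using mult_mem[of a r] by (simp add: mult.commute)

lemma uminus_mem: "a \<in> I \<Longrightarrow> - a \<in> I"
  using mult_mem[of a "-1"] by simp

lemma diff_mem: "a \<in> I \<Longrightarrow> b \<in> I \<Longrightarrow> a - b \<in> I"
  using add_mem[of a "- b"] uminus_mem[of b] by simp

lemma sum_mem: "(\<And>x. x \<in> A \<Longrightarrow> f x \<in> I) \<Longrightarrow> sum f A \<in> I"
  by (induction A rule: infinite_finite_induct) (auto simp: zero_mem add_mem)

lemma dvd_mem: "a \<in> I \<Longrightarrow> a dvd b \<Longrightarrow> b \<in> I"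
  by (auto simp: mult_mem')

lemma power_diff_mem:
  assumes "a - b \<in> I"
  shows "a ^ n - b ^ n \<in> I"
proof (induction n)
  case (Suc n)
  have "a ^ Suc n - b ^ Suc n = a * (a ^ n - b ^ n) + b ^ n * (a - b)"
    by (simp add: algebra_simps)
  with Suc assms show ?case by (auto intro!: add_mem mult_mem)
qed (simp add: zero_mem)

text \<open>Freshman's dream: a prime divides its inner binomial coefficients, so those terms lie in
  \<open>I\<close> and only \<open>x ^ p\<close> and \<open>y ^ p\<close> remain.\<close>

lemma frobenius_add_mem:
  assumes "prime p" and "of_nat p \<in> I"
  shows "(x + y) ^ p - (x ^ p + y ^ p) \<in> I"
proof -
  let ?f = "\<lambda>k. of_nat (p choose k) * x ^ k * y ^ (p - k)"
  have p0: "p > 0" using assms(1) by (simp add: prime_gt_0_nat)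
  have "(x + y) ^ p = (\<Sum>k\<le>p. ?f k)" by (rule binomial_ring)
  also have "{..p} = insert 0 (insert p {1..<p})" using p0 by auto
  also have "sum ?f \<dots> = y ^ p + (x ^ p + (\<Sum>k=1..<p. ?f k))"
    using p0 by simp
  finally have "(x + y) ^ p - (x ^ p + y ^ p) = (\<Sum>k=1..<p. ?f k)" by simp
  also have "\<dots> \<in> I"
  proof (rule sum_mem)
    fix k assume "k \<in> {1..<p}"
    then have "p dvd (p choose k)" using assms(1)
      by (intro dvd_choose_prime) auto
    then have "(of_nat p :: 'a) dvd of_nat (p choose k)" by (auto elim!: dvdE)
    then show "?f k \<in> I" using assms(2) by (intro mult_mem') (rule dvd_mem)
  qed
  finally show ?thesis .
qed

lemma frobenius_power_add_mem:
  assumes "prime p" and "of_nat p \<in> I"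
  shows "(x + y) ^ (p ^ n) - (x ^ (p ^ n) + y ^ (p ^ n)) \<in> I"
proof (induction n)
  case (Suc n)
  let ?u = "x ^ (p ^ n)" and ?v = "y ^ (p ^ n)" and ?w = "(x + y) ^ (p ^ n)"
  have "?w ^ p - (?u ^ p + ?v ^ p) = (?w ^ p - (?u + ?v) ^ p) + ((?u + ?v) ^ p - (?u ^ p + ?v ^ p))"
    by simp
  also have "\<dots> \<in> I"
    using power_diff_mem[OF Suc] frobenius_add_mem[OF assms] by (rule add_mem)
  finally show ?case by (simp add: power_mult[symmetric] mult.commute)
qed (simp add: zero_mem)

end

locale prime_ring_ideal = ring_ideal +
  assumes one_notin: "1 \<notin> I"
    and prime_mem: "a * b \<in> I \<Longrightarrow> a \<in> I \<or> b \<in> I"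
begin

lemma power_mem: "a ^ n \<in> I \<Longrightarrow> a \<in> I"
  by (induction n) (use one_notin prime_mem in auto)

lemma cancel_mem: "a * b \<in> I \<Longrightarrow> a \<notin> I \<Longrightarrow> b \<in> I"
  using prime_mem by blast

text \<open>Linear factors are split off one root at a time: primality cancels \<open>b - a\<close>,
  and the leading coefficient survives because the divisors are monic. This is the bound on the
  number of roots by the degree, read modulo \<open>I\<close>.\<close>

lemma incongruent_roots:
  assumes "\<And>a. a \<in> A \<Longrightarrow> poly g a \<in> I"
    and "\<And>a b. a \<in> A \<Longrightarrow> b \<in> A \<Longrightarrow> a \<noteq> b \<Longrightarrow> a - b \<notin> I"
    and "degree g < card A"
  shows "lead_coeff g \<in> I"
  using assms
proof (induction "degree g" arbitrary: g A)
  case 0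
  then obtain a where "a \<in> A" by fastforce
  moreover obtain c where "g = [:c:]" using 0(1) by (metis degree_eq_zeroE)
  ultimately show ?case using 0(2)[of a] by simp
next
  case (Suc n)
  have "card A > 0" using Suc.prems(3) by linarith
  then have fin: "finite A" "A \<noteq> {}" by (auto simp: card_gt_0_iff)
  then obtain a where a: "a \<in> A" by blast
  define h where "h = synthetic_div g a"
  \<comment> \<open>The remainder \<open>poly g a\<close> may be nonzero; it lies in
    \<open>I\<close>, so it disappears modulo \<open>I\<close>.\<close>
  have g: "g = [:-a, 1:] * h + [:poly g a:]"
    unfolding h_def using synthetic_div_correct'[of a g] by simp
  have dh: "degree h = n" unfolding h_def using Suc(2) by (simp add: degree_synthetic_div)
  have "lead_coeff h \<in> I"
  proof (rule Suc.hyps(1)[of _ "A - {a}"])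
    show "poly h b \<in> I" if "b \<in> A - {a}" for b
    proof -
      have "poly g b = (b - a) * poly h b + poly g a"
        by (subst g) (simp add: algebra_simps)
      then have "(b - a) * poly h b = poly g b - poly g a" by simp
      then have "(b - a) * poly h b \<in> I" using Suc.prems(1) a that by (simp add: diff_mem)
      then show ?thesis using Suc.prems(2)[of b a] that a cancel_mem by blast
    qed
  qed (use dh Suc fin a in auto)
  moreover have "lead_coeff g = lead_coeff h"
  proof -
    have "coeff g (Suc n) = coeff h n"
      by (subst g) (use dh in \<open>simp add: coeff_pCons coeff_eq_0\<close>)
    then show ?thesis using Suc(2) dh by simp
  qed
  ultimately show ?case by simp
qed

end

text \<open>Zorn's lemma gives a maximal ideal above \<open>J\<close> among those avoiding 1.
  Elements outside it are invertible modulo it, which makes it prime.\<close>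

lemma exists_prime_ring_ideal:
  fixes J :: "'a :: comm_ring_1 set"
  assumes "ring_ideal J" and "1 \<notin> J"
  shows "\<exists>I. prime_ring_ideal I \<and> J \<subseteq> I"
proof -
  let ?S = "{I. ring_ideal I \<and> J \<subseteq> I \<and> 1 \<notin> I}"
  have "\<exists>M\<in>?S. \<forall>X\<in>?S. M \<subseteq> X \<longrightarrow> X = M"
  proof (rule subset_Zorn_nonempty)
    show "?S \<noteq> {}" using assms by auto
    fix C assume C: "C \<noteq> {}" "subset.chain ?S C"
    then have sub: "C \<subseteq> ?S" and lin: "\<And>X Y. X \<in> C \<Longrightarrow> Y \<in> C \<Longrightarrow> X \<subseteq> Y \<or> Y \<subseteq> X"
      unfolding subset_chain_def by blast+
    have "ring_ideal (\<Union>C)"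
    proof
      show "0 \<in> \<Union>C" using C(1) sub ring_ideal.zero_mem by blast
      show "r * a \<in> \<Union>C" if "a \<in> \<Union>C" for a r
        using that sub ring_ideal.mult_mem by blast
      show "a + b \<in> \<Union>C" if ab: "a \<in> \<Union>C" "b \<in> \<Union>C" for a b
      proof -
        obtain X Y where "X \<in> C" "Y \<in> C" "a \<in> X" "b \<in> Y" using ab by blast
        then obtain Z where "Z \<in> C" "a \<in> Z" "b \<in> Z" using lin by blast
        then show ?thesis using sub ring_ideal.add_mem by blast
      qed
    qed
    then show "\<Union>C \<in> ?S" using C(1) sub by blast
  qed
  then obtain M where MS: "M \<in> ?S" and maxS: "\<forall>X\<in>?S. M \<subseteq> X \<longrightarrow> X = M" by (rule bexE)
  from MS have M: "ring_ideal M" "J \<subseteq> M" "1 \<notin> M" by auto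
  have max: "X = M" if "ring_ideal X" "M \<subseteq> X" "1 \<notin> X" for X
    using maxS that M(2) by auto
  interpret M: ring_ideal M by fact
  have inv: "\<exists>r. 1 - r * a \<in> M" if "a \<notin> M" for a
  proof -
    \<comment> \<open>\<open>?X\<close> is the ideal generated by \<open>M\<close> and
      \<open>a\<close>. It properly extends \<open>M\<close>, so by maximality it contains
      1.\<close>
    let ?X = "{x. \<exists>r. x - r * a \<in> M}"
    have "ring_ideal ?X"
    proof
      show "0 \<in> ?X" using M.zero_mem by (auto intro!: exI[of _ 0])
      show "x + y \<in> ?X" if xy: "x \<in> ?X" "y \<in> ?X" for x y
      proof -
        obtain r s where "x - r * a \<in> M" "y - s * a \<in> M" using xy by blast
        then have "(x - r * a) + (y - s * a) \<in> M" by (rule M.add_mem)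
        then show ?thesis by (auto simp: algebra_simps intro!: exI[of _ "r + s"])
      qed
      show "s * x \<in> ?X" if x: "x \<in> ?X" for x s
      proof -
        obtain r where "x - r * a \<in> M" using x by blast
        then have "s * (x - r * a) \<in> M" by (rule M.mult_mem)
        then show ?thesis by (auto simp: algebra_simps intro!: exI[of _ "s * r"])
      qed
    qed
    moreover have "M \<subseteq> ?X" by (auto intro!: exI[of _ 0])
    moreover have "a \<in> ?X" using M.zero_mem by (auto intro!: exI[of _ 1])
    ultimately show ?thesis using max that by blast
  qed
  have "a \<in> M \<or> b \<in> M" if ab: "a * b \<in> M" for a b
  proof (rule ccontr)
    assume "\<not> ?thesis"
    then obtain r s where "1 - r * a \<in> M" "1 - s * b \<in> M" using inv by blast
    \<comment> \<open>The three summands add up to 1.\<close>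
    then have "(1 - r * a) + (r * a) * (1 - s * b) + (r * s) * (a * b) \<in> M"
      using ab by (intro M.add_mem M.mult_mem[where r = "r * a"] M.mult_mem[where r = "r * s"])
    then show False using M(3) by (simp add: algebra_simps)
  qed
  then have "prime_ring_ideal M" using M(3) by unfold_locales blast+
  with M show ?thesis by blast
qed

subsection \<open>The field with q elements as a residue ring of the integer polynomials\<close>

definition int_poly_eval :: "int poly \<Rightarrow> complex \<Rightarrow> complex" where
  "int_poly_eval h z = poly (map_poly of_int h) z"

lemma int_poly_eval_0 [simp]: "int_poly_eval 0 z = 0"
  and int_poly_eval_1 [simp]: "int_poly_eval 1 z = 1"
  and int_poly_eval_monom [simp]: "int_poly_eval (monom 1 d) z = z ^ d"
  and int_poly_eval_pCons [simp]: "int_poly_eval (pCons a h) z = of_int a + z * int_poly_eval h z"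
  by (simp_all add: int_poly_eval_def map_poly_monom poly_monom map_poly_pCons)

lemma int_poly_eval_add [simp]: "int_poly_eval (g + h) z = int_poly_eval g z + int_poly_eval h z"
proof -
  have "map_poly of_int (g + h) = (map_poly of_int g + map_poly of_int h :: complex poly)"
    by (rule poly_eqI) (simp add: coeff_map_poly)
  then show ?thesis by (simp add: int_poly_eval_def)
qed

lemma int_poly_eval_diff [simp]: "int_poly_eval (g - h) z = int_poly_eval g z - int_poly_eval h z"
  using int_poly_eval_add[of "g - h" h z] by (simp add: algebra_simps)

lemma int_poly_eval_smult [simp]: "int_poly_eval (smult a h) z = of_int a * int_poly_eval h z"
  by (induction h) (simp_all add: algebra_simps)

lemma int_poly_eval_mult [simp]: "int_poly_eval (g * h) z = int_poly_eval g z * int_poly_eval h z"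
  by (induction g) (simp_all add: algebra_simps)

lemma int_poly_eval_prod_mset [simp]:
  "int_poly_eval (prod_mset A) z = (\<Prod>g\<in>#A. int_poly_eval g z)"
  by (induction A) simp_all

text \<open>Z[X] is factorial and the complex numbers have no zero divisors, so one of the prime
  factors already vanishes at \<open>z\<close>.\<close>

lemma prime_divisor_with_root:
  assumes "h \<noteq> 0" and "int_poly_eval h z = 0"
  shows "\<exists>f. prime_elem f \<and> f dvd h \<and> int_poly_eval f z = 0"
proof -
  let ?P = "prod_mset (prime_factorization h)"
  have "h dvd ?P" using prod_mset_prime_factorization_weak[OF assms(1)]
    by (metis associated_iff_dvd)
  then have "int_poly_eval ?P z = 0" using assms(2) by (metis dvdE int_poly_eval_mult mult_zero_left)
  then obtain f where f: "f \<in># prime_factorization h" "int_poly_eval f z = 0"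
    by (auto simp: prod_mset_zero_iff)
  then have "prime f" "f dvd h" by (auto dest: in_prime_factors_imp_prime in_prime_factors_imp_dvd)
  then show ?thesis using f(2) by (auto intro: prime_imp_prime_elem)
qed

lemma exists_primitive_root_of_unity:
  assumes "m > 0"
  shows "\<exists>z::complex. z ^ m = 1 \<and> (\<forall>d. 0 < d \<and> d < m \<longrightarrow> z ^ d \<noteq> 1)"
proof (intro exI conjI allI impI)
  let ?c = "\<lambda>k. cis (2 * pi * real k / real m)"
  note bij = bij_betw_roots_unity[OF assms]
  have pow: "?c 1 ^ d = ?c d" for d by (simp add: DeMoivre mult_ac)
  show "?c 1 ^ m = 1" using assms unfolding pow by simp
  fix d assume d: "0 < d \<and> d < m"
  show "?c 1 ^ d \<noteq> 1"
  proof
    assume "?c 1 ^ d = 1"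
    then have "?c d = ?c 0" unfolding pow by simp
    moreover have "d \<in> {..<m}" "0 \<in> {..<m}" using d by auto
    ultimately have "d = 0" using bij_betw_imp_inj_on[OF bij] by (rule inj_onD[rotated])
    with d show False by simp
  qed
qed

text \<open>\<open>f\<close> plays the part of the \<open>m\<close>-th cyclotomic polynomial: it
  vanishes at a primitive \<open>m\<close>-th root of unity, whereas \<open>monom 1 d - 1\<close>
  does not for \<open>0 < d < m\<close>.\<close>

lemma exists_primitive_prime_divisor:
  assumes "m > 0"
  shows "\<exists>f :: int poly. prime_elem f \<and> f dvd monom 1 m - 1 \<and>
           (\<forall>d. 0 < d \<and> d < m \<longrightarrow> \<not> f dvd monom 1 d - 1)"
proof -
  obtain z :: complex where z: "z ^ m = 1" "\<And>d. 0 < d \<Longrightarrow> d < m \<Longrightarrow> z ^ d \<noteq> 1"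
    using exists_primitive_root_of_unity[OF assms] by blast
  have "coeff (monom 1 m - 1 :: int poly) m \<noteq> 0" using assms by simp
  then have "monom 1 m - 1 \<noteq> (0 :: int poly)" by force
  then obtain f where f: "prime_elem f" "f dvd monom 1 m - 1" "int_poly_eval f z = 0"
    using prime_divisor_with_root[of "monom 1 m - 1" z] z(1) by auto
  have "\<not> f dvd monom 1 d - 1" if d: "0 < d" "d < m" for d
  proof
    assume "f dvd monom 1 d - 1"
    then have "int_poly_eval (monom 1 d - 1) z = 0" using f(3) by (metis dvdE int_poly_eval_mult mult_zero_left)
    then show False using z(2)[OF d] by simp
  qed
  with f show ?thesis by blast
qed

text \<open>Modulo \<open>p\<close> the equation would read \<open>f * b = 1\<close>, which degrees
  forbid: \<open>f\<close> keeps its positive degree because its leading coefficient is 1 or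
  -1.\<close>

lemma one_notin_prime_monic_ideal:
  fixes f :: "int poly"
  assumes p: "prime p" and lead: "\<bar>lead_coeff f\<bar> = 1" and deg: "degree f > 0"
  shows "1 \<noteq> [:p:] * a + f * b"
proof
  assume eq: "1 = [:p:] * a + f * b"
  let ?K = "{i. \<not> p dvd coeff b i}"
  have ceq: "coeff 1 n = p * coeff a n + coeff (f * b) n" for n
    by (subst eq) simp
  have fin: "finite ?K"
    by (rule finite_subset[of _ "{..degree b}"]) (auto intro: le_degree)
  show False
  proof (cases "?K = {}")
    case True
    then have "p dvd coeff (f * b) 0" by (simp add: coeff_mult)
    then have "p dvd coeff 1 0" unfolding ceq[of 0] by simp
    then show False using p by auto
  next
    case False
    \<comment> \<open>\<open>k\<close> is the degree of \<open>b\<close> modulo \<open>p\<close>. In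
      degree \<open>degree f + k\<close> the product is congruent to
      \<open>lead_coeff f * coeff b k\<close>: every other term has a factor \<open>coeff b\<close>
      beyond \<open>k\<close> or a factor \<open>coeff f\<close> beyond the degree.\<close>
    define k where "k = Max ?K"
    have k: "\<not> p dvd coeff b k" using Max_in[OF fin False] by (simp add: k_def)
    have above: "p dvd coeff b i" if "i > k" for i
      using Max_ge[OF fin, of i] that by (fastforce simp: k_def)
    let ?n = "degree f + k"
    have "p dvd coeff (f * b) ?n"
    proof
      have "coeff (1 :: int poly) ?n = 0" using deg by simp
      then show "coeff (f * b) ?n = p * - coeff a ?n" using ceq[of ?n] by linarith
    qed
    moreover have "coeff (f * b) ?n = lead_coeff f * coeff b k +
        (\<Sum>i\<in>{..?n} - {degree f}. coeff f i * coeff b (?n - i))"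
      unfolding coeff_mult by (subst sum.remove[of _ "degree f"]) auto
    moreover have "p dvd (\<Sum>i\<in>{..?n} - {degree f}. coeff f i * coeff b (?n - i))"
    proof (rule dvd_sum)
      fix i assume i: "i \<in> {..?n} - {degree f}"
      show "p dvd coeff f i * coeff b (?n - i)"
      proof (cases "i < degree f")
        case True
        then show ?thesis using above[of "?n - i"] by simp
      next
        case False
        then show ?thesis using i by (simp add: coeff_eq_0)
      qed
    qed
    ultimately have "p dvd lead_coeff f * coeff b k" by (simp add: dvd_add_left_iff)
    then have "p dvd coeff b k" using lead by (auto simp: abs_if split: if_splits dest: minus_equation_iff[THEN iffD1])
    with k show False by simp
  qed
qed


text \<open>The \<open>t k\<close> are incongruent because \<open>X\<close> has order exactly
  \<open>q - 1\<close> modulo \<open>I\<close>. They exhaust the classes because every element is a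
  root of \<open>Y^q - Y\<close>: these roots form a subring containing the constants and
  \<open>X\<close>, and an element missed by \<open>t\<close> would be root number
  \<open>q + 1\<close>.\<close>

theorem exists_residue_field:
  fixes q :: nat
  assumes "primepow q"
  shows "\<exists>(I :: int poly set) t. prime_ring_ideal I \<and> t 0 = 0 \<and>
           (\<forall>x. \<exists>k<q. x - t k \<in> I) \<and> (\<forall>j<q. \<forall>k<q. t j - t k \<in> I \<longrightarrow> j = k)"
proof -
  obtain p n where p: "prime p" "n > 0" and q: "q = p ^ n"
    using assms by (auto simp: primepow_def)
  have q2: "q \<ge> 2" using primepow_gt_Suc_0[OF assms] by simp
  define m where "m = q - 1"
  have m: "m > 0" "q = Suc m" using q2 by (auto simp: m_def)
  let ?X = "monom 1 :: nat \<Rightarrow> int poly"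
  obtain f where f: "prime_elem f" "f dvd ?X m - 1"
    and prim: "\<And>d. 0 < d \<Longrightarrow> d < m \<Longrightarrow> \<not> f dvd ?X d - 1"
    using exists_primitive_prime_divisor[OF m(1)] by blast
  obtain g where g: "?X m - 1 = f * g" using f(2) by (elim dvdE)
  \<comment> \<open>A divisor of a monic integer polynomial has leading coefficient 1 or -1, as
    required for the ideal generated by \<open>p\<close> and \<open>f\<close> to be proper.\<close>
  have "lead_coeff (?X m - 1) = 1"
  proof -
    have "degree (?X m + (-1)) = m"
      using m(1) by (subst degree_add_eq_left) (simp_all add: degree_monom_eq)
    then show ?thesis using m(1) by simp
  qed
  then have lead: "lead_coeff f * lead_coeff g = 1" unfolding g by (simp add: lead_coeff_mult)
  then have lead1: "\<bar>lead_coeff f\<bar> = 1" by (auto simp: zmult_eq_1_iff)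
  have deg: "degree f > 0"
  proof (rule ccontr)
    assume "\<not> ?thesis"
    then obtain c where c: "f = [:c:]" by (metis degree_eq_zeroE neq0_conv)
    then have "is_unit f" using lead1 by (simp add: is_unit_const_poly_iff)
    then show False using f(1) by (simp add: prime_elem_def)
  qed
  let ?J = "{[:int p:] * a + f * b | a b. True}"
  have J: "ring_ideal ?J"
  proof
    show "0 \<in> ?J" by (auto intro!: exI[of _ 0])
    show "x + y \<in> ?J" if xy: "x \<in> ?J" "y \<in> ?J" for x y
    proof -
      obtain a b c d where "x = [:int p:] * a + f * b" "y = [:int p:] * c + f * d" using xy by blast
      then have "x + y = [:int p:] * (a + c) + f * (b + d)" by (simp add: algebra_simps smult_add_right)
      then show ?thesis by blast
    qed
    show "r * x \<in> ?J" if x: "x \<in> ?J" for x r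
    proof -
      obtain a b where "x = [:int p:] * a + f * b" using x by blast
      then have "r * x = [:int p:] * (r * a) + f * (r * b)" by (simp add: algebra_simps)
      then show ?thesis by blast
    qed
  qed
  moreover have "1 \<notin> ?J"
    using one_notin_prime_monic_ideal[of "int p" f] p(1) lead1 deg by auto
  ultimately obtain I where "prime_ring_ideal I" and JI: "?J \<subseteq> I"
    using exists_prime_ring_ideal by blast
  then interpret prime_ring_ideal I by simp
  have "[:int p:] * 1 + f * 0 \<in> ?J" by blast
  then have pI: "of_nat p \<in> I" using JI by (auto simp: of_nat_poly)
  have "[:int p:] * 0 + f * 1 \<in> ?J" by blast
  then have fI: "f \<in> I" using JI by auto
  have qI: "of_nat q \<in> I"
    by (rule dvd_mem[OF pI]) (use p(2) in \<open>simp add: q dvd_power\<close>)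
  have XmI: "?X m - 1 \<in> I" using dvd_mem[OF fI f(2)] .
  have XI: "?X j \<notin> I" for j
  proof
    assume "?X j \<in> I"
    then have "?X 1 ^ j \<in> I" by (simp add: monom_power)
    then have "?X 1 \<in> I" by (rule power_mem)
    then have "?X m \<in> I" by (rule dvd_mem) (auto simp: m(2) mult_monom intro!: dvdI[of _ _ "?X (m - 1)"] simp: m(1) Suc_leI)
    then have "?X m - (?X m - 1) \<in> I" using XmI by (rule diff_mem)
    then show False using one_notin by simp
  qed
  have Xd: "?X d - 1 \<notin> I" if d: "0 < d" "d < m" for d
  proof
    assume A: "?X d - 1 \<in> I"
    \<comment> \<open>\<open>f\<close> divides \<open>(?X d - 1) * ?s\<close> but not the first
      factor, so it divides \<open>?s\<close>. If \<open>?X d\<close> is congruent to 1, then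
      \<open>?s\<close> is congruent to \<open>m = q - 1\<close>, and \<open>I\<close> contains both
      \<open>q - 1\<close> and \<open>q\<close>.\<close>
    let ?s = "\<Sum>i<m. ?X d ^ i"
    have "(?X d - 1) * ?s = ?X d ^ m - 1" by (rule power_diff_1_eq[symmetric])
    also have "\<dots> = ?X m ^ d - 1" by (simp add: monom_power mult.commute)
    also have "f dvd \<dots>" using f(2) by (rule dvd_trans) (simp add: power_diff_1_eq)
    finally have "f dvd ?s" using f(1) prim[OF d] by (auto simp: prime_elem_dvd_mult_iff)
    then have "?s \<in> I" by (rule dvd_mem[OF fI])
    moreover have "(\<Sum>i<m. ?X d ^ i - 1 ^ i) \<in> I"
      by (rule sum_mem) (rule power_diff_mem[OF A])
    ultimately have "of_nat q - (?s - (\<Sum>i<m. ?X d ^ i - 1 ^ i)) \<in> I" using qI by (intro diff_mem)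
    then show False using one_notin m(2) by (simp add: sum_subtractf)
  qed
  \<comment> \<open>With 0 at index 0, the \<open>q - 1\<close> distinct powers of \<open>X\<close>
    fill the indices from 1 to \<open>q - 1\<close>.\<close>
  define t where "t k = (case k of 0 \<Rightarrow> 0 | Suc j \<Rightarrow> ?X j)" for k
  have lt: "t j - t k \<notin> I" if jk: "j < k" "k < q" for j k
  proof (cases j)
    case 0
    then show ?thesis using jk XI uminus_mem[of "- t k"] by (cases k) (auto simp: t_def)
  next
    case (Suc i)
    then obtain l where l: "k = Suc l" "i < l" "l < m" using jk m(2) by (cases k) auto
    have "t j - t k = - (?X i * (?X (l - i) - 1))"
      using l Suc by (simp add: t_def mult_monom algebra_simps)
    moreover have "?X i * (?X (l - i) - 1) \<notin> I" using XI[of i] Xd[of "l - i"] l prime_mem less_imp_diff_less by (metis zero_less_diff)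
    ultimately show ?thesis using uminus_mem by fastforce
  qed
  have inj: "j = k" if "j < q" "k < q" "t j - t k \<in> I" for j k
    using lt[of j k] lt[of k j] that uminus_mem[of "t j - t k"] by (cases j k rule: linorder_cases) auto
  let ?S = "{x. x ^ q - x \<in> I}"
  have S_add: "x + y \<in> ?S" if "x \<in> ?S" "y \<in> ?S" for x y
  proof -
    have "(x + y) ^ q - (x ^ q + y ^ q) + ((x ^ q - x) + (y ^ q - y)) \<in> I"
      using that unfolding q by (intro add_mem frobenius_power_add_mem[OF p(1) pI]) auto
    then show ?thesis by (simp add: algebra_simps)
  qed
  have S_mult: "x * y \<in> ?S" if "x \<in> ?S" "y \<in> ?S" for x y
  proof -
    have "x ^ q * (y ^ q - y) + y * (x ^ q - x) \<in> I" using that by (auto intro!: add_mem mult_mem)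
    then show ?thesis by (simp add: algebra_simps power_mult_distrib)
  qed
  have S_0: "0 \<in> ?S" and S_1: "1 \<in> ?S" using q2 zero_mem by (auto simp: power_0_left)
  have S_uminus: "- x \<in> ?S" if "x \<in> ?S" for x
  proof -
    \<comment> \<open>Frobenius applied to \<open>x + - x = 0\<close> avoids a case split on the
      parity of \<open>q\<close>.\<close>
    have "(x + - x) ^ q - (x ^ q + (- x) ^ q) \<in> I"
      using frobenius_power_add_mem[OF p(1) pI, of x "- x" n] by (simp add: q)
    then have "(x + - x) ^ q - (x ^ q + (- x) ^ q) + (x ^ q - x) \<in> I" using that by (intro add_mem) auto
    from uminus_mem[OF this] show ?thesis using q2 by (simp add: power_0_left add.commute)
  qed
  have S_const: "[:c:] \<in> ?S" for c
  proof -
    have nat: "of_nat k \<in> ?S" for k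
      using S_0 S_add[OF S_1] by (induction k) auto
    show ?thesis
      using nat[of "nat c"] S_uminus[OF nat[of "nat (- c)"]] by (cases "c \<ge> 0") (auto simp: of_nat_poly)
  qed
  have "?X 1 * (?X m - 1) \<in> I" using XmI by (intro mult_mem)
  then have S_X: "?X 1 \<in> ?S" by (simp add: algebra_simps mult_monom monom_power m(2))
  have S: "x \<in> ?S" for x
  proof (induction x)
    case 0
    show ?case by (rule S_0)
  next
    case (pCons c x)
    have "pCons c x = [:c:] + ?X 1 * x" by (simp add: monom_altdef)
    then show ?case using S_add[OF S_const S_mult[OF S_X pCons(2)]] by metis
  qed
  have "\<exists>k<q. x - t k \<in> I" for x
  proof (rule ccontr)
    assume A: "\<not> ?thesis"
    let ?A = "insert x (t ` {..<q})" and ?g = "monom 1 q - monom 1 1 :: int poly poly"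
    have xn: "x \<noteq> t k" if "k < q" for k using A that zero_mem by auto
    have "inj_on t {..<q}" using inj zero_mem by (auto intro!: inj_onI)
    then have card: "card ?A = Suc q" using xn by (subst card_insert_disjoint) (auto simp: card_image)
    have "degree ?g = q" and lc: "lead_coeff ?g = 1"
    proof -
      have "degree (monom 1 q + - monom (1 :: int poly) 1) = q"
        using q2 by (subst degree_add_eq_left) (simp_all add: degree_monom_eq)
      then show "degree ?g = q" by simp
      then show "lead_coeff ?g = 1" using q2 by simp
    qed
    moreover have "a - b \<notin> I" if "a \<in> ?A" "b \<in> ?A" "a \<noteq> b" for a b
    proof
      assume "a - b \<in> I"
      then have "a - b \<in> I" "b - a \<in> I" using uminus_mem[of "a - b"] by simp_all
      then show False using that A inj by auto
    qed
    moreover have "poly ?g a \<in> I" for a using S[of a] by (simp add: poly_monom)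
    ultimately have "lead_coeff ?g \<in> I" using card by (intro incongruent_roots[of ?A]) auto
    then show False using lc one_notin by simp
  qed
  moreover have "t 0 = 0" by (simp add: t_def)
  ultimately show ?thesis using inj \<open>prime_ring_ideal I\<close> by blast
qed

subsection \<open>Arrays from the tangent lines of the twisted cubic\<close>

text \<open>Counting reduces each bijectivity requirement on the arrays to injectivity, that is, to
  a linear system having only the zero solution.\<close>

lemma bij_betw_of_inj_on_card:
  assumes "finite B" and "card A = card B" and "inj_on f A" and "\<And>x. x \<in> A \<Longrightarrow> f x \<in> B"
  shows "bij_betw f A B"
  using assms card_subset_eq[of B "f ` A"] by (auto simp: bij_betw_def card_image)

lemma eq_of_div_mod_eq: "(m :: nat) div q = n div q \<Longrightarrow> m mod q = n mod q \<Longrightarrow> m = n"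
  by (metis div_mult_mod_eq)

section \<open>Linear systems and Hermite interpolation modulo a prime ideal\<close>

context prime_ring_ideal
begin

lemma cramer_mem:
  assumes "a * u + b * v \<in> I" and "c * u + d * v \<in> I" and "a * d - b * c \<notin> I"
  shows "u \<in> I" and "v \<in> I"
proof -
  have "d * (a * u + b * v) - b * (c * u + d * v) \<in> I"
    and "a * (c * u + d * v) - c * (a * u + b * v) \<in> I"
    using assms by (auto intro!: diff_mem mult_mem)
  then have "(a * d - b * c) * u \<in> I" "(a * d - b * c) * v \<in> I"
    by (simp_all add: algebra_simps)
  then show "u \<in> I" "v \<in> I" using assms(3) cancel_mem by blast+
qed

text \<open>Expanding the quadratic \<open>a + b Y + c Y^2\<close> around its double zero
  \<open>m\<close> leaves the value \<open>(l - m) ^ 2 * c\<close> at \<open>l\<close>. Nothing is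
  divided by 2, so characteristic 2 is covered.\<close>

lemma hermite_quadratic:
  assumes "l - m \<notin> I"
    and pl: "a + l * b + l ^ 2 * c \<in> I" and pm: "a + m * b + m ^ 2 * c \<in> I"
    and dm: "b + 2 * m * c \<in> I"
  shows "a \<in> I" and "b \<in> I" and "c \<in> I"
proof -
  have "(a + l * b + l ^ 2 * c) - (a + m * b + m ^ 2 * c) - (l - m) * (b + 2 * m * c) \<in> I"
    using assms by (intro diff_mem mult_mem)
  also have "(a + l * b + l ^ 2 * c) - (a + m * b + m ^ 2 * c) - (l - m) * (b + 2 * m * c)
      = (l - m) * ((l - m) * c)"
    by (simp add: algebra_simps power2_eq_square)
  finally show c: "c \<in> I" using assms(1) cancel_mem by blast
  have "(b + 2 * m * c) - (2 * m) * c \<in> I" using dm mult_mem[OF c] by (rule diff_mem)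
  then show b: "b \<in> I" by simp
  have "(a + m * b + m ^ 2 * c) - (m * b + m ^ 2 * c) \<in> I"
    using pm add_mem[OF mult_mem[OF b] mult_mem[OF c]] by (rule diff_mem)
  then show "a \<in> I" by simp
qed

text \<open>The first-order Taylor expansions around \<open>l\<close> and around \<open>m\<close>
  leave remainders \<open>(l - m) ^ 2\<close> times \<open>c + d * (2 * l + m)\<close> and
  \<open>c + d * (2 * m + l)\<close>. The difference of these cofactors is
  \<open>(l - m) * d\<close>; with \<open>d\<close> gone, the quadratic case applies.\<close>

lemma hermite_cubic:
  assumes "l - m \<notin> I"
    and pl: "a + l * b + l ^ 2 * c + l ^ 3 * d \<in> I" and pm: "a + m * b + m ^ 2 * c + m ^ 3 * d \<in> I"
    and dl: "b + 2 * l * c + 3 * l ^ 2 * d \<in> I" and dm: "b + 2 * m * c + 3 * m ^ 2 * d \<in> I"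
  shows "a \<in> I" and "b \<in> I" and "c \<in> I" and "d \<in> I"
proof -
  let ?pl = "a + l * b + l ^ 2 * c + l ^ 3 * d" and ?pm = "a + m * b + m ^ 2 * c + m ^ 3 * d"
  let ?dl = "b + 2 * l * c + 3 * l ^ 2 * d" and ?dm = "b + 2 * m * c + 3 * m ^ 2 * d"
  have "?pm - ?pl - (m - l) * ?dl \<in> I" and "?pl - ?pm - (l - m) * ?dm \<in> I"
    using assms by (safe intro!: diff_mem[OF diff_mem mult_mem])
  moreover have "?pm - ?pl - (m - l) * ?dl = (l - m) * ((l - m) * (c + d * (2 * l + m)))"
    and "?pl - ?pm - (l - m) * ?dm = (l - m) * ((l - m) * (c + d * (2 * m + l)))"
    by (simp_all add: algebra_simps power2_eq_square power3_eq_cube)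
  ultimately have e: "c + d * (2 * l + m) \<in> I" "c + d * (2 * m + l) \<in> I"
    using assms(1) cancel_mem by metis+
  then have "(c + d * (2 * l + m)) - (c + d * (2 * m + l)) \<in> I" by (rule diff_mem)
  also have "(c + d * (2 * l + m)) - (c + d * (2 * m + l)) = (l - m) * d"
    by (simp add: algebra_simps)
  finally show d: "d \<in> I" using assms(1) cancel_mem by blast
  have "?pl - l ^ 3 * d \<in> I" "?pm - m ^ 3 * d \<in> I" "?dm - 3 * m ^ 2 * d \<in> I"
    by (intro diff_mem pl pm dm mult_mem d)+
  then have q: "a + l * b + l ^ 2 * c \<in> I" "a + m * b + m ^ 2 * c \<in> I" "b + 2 * m * c \<in> I"
    by simp_all
  show "a \<in> I" "b \<in> I" "c \<in> I" using hermite_quadratic[OF assms(1) q] by blast+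
qed

end

section \<open>Residue classes coded as digits, and arrays of linear forms\<close>

locale coded_residue_field = prime_ring_ideal I for I :: "'a :: comm_ring_1 set" +
  fixes q :: nat and t :: "nat \<Rightarrow> 'a"
  assumes t_0: "t 0 = 0"
    and t_surj: "\<exists>k<q. x - t k \<in> I"
    and t_inj: "j < q \<Longrightarrow> k < q \<Longrightarrow> t j - t k \<in> I \<Longrightarrow> j = k"
begin

definition code :: "'a \<Rightarrow> nat" where
  "code x = (SOME k. k < q \<and> x - t k \<in> I)"

lemma code_less: "code x < q" and diff_code_mem: "x - t (code x) \<in> I"
  using someI_ex[OF t_surj[of x]] by (simp_all add: code_def)

lemma q_pos: "0 < q"
  using code_less[of 0] by simp

lemma code_eqD:
  assumes "code x = code y"
  shows "x - y \<in> I"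
proof -
  have "(x - t (code x)) - (y - t (code x)) \<in> I"
    using diff_code_mem[of x] diff_code_mem[of y] unfolding assms by (rule diff_mem)
  then show ?thesis by simp
qed

text \<open>The base-\<open>q\<close> digits of row and column are the four coordinates of a cell:
  \<open>a1\<close> and \<open>a3\<close> weigh the large row and large column, \<open>a2\<close>
  and \<open>a4\<close> the position inside the subsquare.\<close>

definition lin :: "'a \<Rightarrow> 'a \<Rightarrow> 'a \<Rightarrow> 'a \<Rightarrow> nat \<Rightarrow> nat \<Rightarrow> 'a" where
  "lin a1 a2 a3 a4 r c = a1 * t (r div q) + a2 * t (r mod q) + a3 * t (c div q) + a4 * t (c mod q)"

lemma lin_diff:
  "lin a1 a2 a3 a4 r c - lin a1 a2 a3 a4 r' c' =
     a1 * (t (r div q) - t (r' div q)) + a2 * (t (r mod q) - t (r' mod q)) +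
     a3 * (t (c div q) - t (c' div q)) + a4 * (t (c mod q) - t (c' mod q))"
  by (simp add: lin_def algebra_simps)

definition pair_symbol :: "'a \<Rightarrow> 'a \<Rightarrow> nat" where
  "pair_symbol x y = q * code x + code y"

lemma pair_symbol_less: "pair_symbol x y < q ^ 2"
proof -
  have "pair_symbol x y < q * code x + q" using code_less[of y] by (simp add: pair_symbol_def)
  also have "\<dots> = q * Suc (code x)" by simp
  also have "\<dots> \<le> q * q" using code_less[of x] by (intro mult_le_mono) simp_all
  finally show ?thesis by (simp add: power2_eq_square)
qed

lemma pair_symbol_div [simp]: "pair_symbol x y div q = code x"
  using code_less[of y] q_pos by (simp add: pair_symbol_def)

lemma pair_symbol_mod [simp]: "pair_symbol x y mod q = code y"
  using code_less[of y] by (simp add: pair_symbol_def)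

lemma pair_symbol_eqD:
  assumes "pair_symbol x y = pair_symbol x' y'"
  shows "x - x' \<in> I" and "y - y' \<in> I"
  using assms by (metis code_eqD pair_symbol_div, metis code_eqD pair_symbol_mod)

lemma less_square_div: "r < q ^ 2 \<Longrightarrow> r div q < q"
  by (simp add: power2_eq_square less_mult_imp_div_less)

lemma index_eqI:
  assumes "r < q ^ 2" and "r' < q ^ 2"
    and "t (r div q) - t (r' div q) \<in> I" and "t (r mod q) - t (r' mod q) \<in> I"
  shows "r = r'"
  using assms q_pos by (intro eq_of_div_mod_eq[of r q r'] t_inj) (auto intro: less_square_div)

lemma block_less_square:
  assumes "r < x * q + q" and "x < q"
  shows "r < q ^ 2"
proof -
  have "x * q + q = Suc x * q" by simp
  also have "\<dots> \<le> q * q" using assms(2) by (intro mult_le_mono1) simp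
  finally show ?thesis using assms(1) by (simp add: power2_eq_square)
qed

lemma cell_div_mod:
  assumes "r < q"
  shows "(a * q + r) div q = a" and "(a * q + r) mod q = r"
  using assms q_pos by simp_all

text \<open>In a row only the coordinates of \<open>a3, a4\<close> vary, in a column those of
  \<open>a1, a2\<close>, in a subsquare those of \<open>a2, a4\<close>. In each case the 2 by 2
  minor decides injectivity.\<close>

lemma sudoku_lin:
  assumes row: "a3 * b4 - a4 * b3 \<notin> I" and col: "a1 * b2 - a2 * b1 \<notin> I"
    and sub: "a2 * b4 - a4 * b2 \<notin> I"
  shows "sudoku q (\<lambda>r c. pair_symbol (lin a1 a2 a3 a4 r c) (lin b1 b2 b3 b4 r c))" (is "sudoku q ?A")
  unfolding sudoku_def
proof (intro conjI allI impI)
  fix r assume "r < q ^ 2"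
  show "bij_betw (\<lambda>c. ?A r c) {0..<q ^ 2} {0..<q ^ 2}"
  proof (rule bij_betw_of_inj_on_card)
    show "inj_on (\<lambda>c. ?A r c) {0..<q ^ 2}"
    proof (rule inj_onI)
      fix c c' assume c: "c \<in> {0..<q ^ 2}" "c' \<in> {0..<q ^ 2}" and "?A r c = ?A r c'"
      then have "a3 * (t (c div q) - t (c' div q)) + a4 * (t (c mod q) - t (c' mod q)) \<in> I"
        and "b3 * (t (c div q) - t (c' div q)) + b4 * (t (c mod q) - t (c' mod q)) \<in> I"
        by (auto dest: pair_symbol_eqD simp: lin_diff)
      from cramer_mem[OF this row] show "c = c'" using c by (auto intro: index_eqI)
    qed
  qed (auto simp: pair_symbol_less)
next
  fix c assume "c < q ^ 2"
  show "bij_betw (\<lambda>r. ?A r c) {0..<q ^ 2} {0..<q ^ 2}"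
  proof (rule bij_betw_of_inj_on_card)
    show "inj_on (\<lambda>r. ?A r c) {0..<q ^ 2}"
    proof (rule inj_onI)
      fix r r' assume r: "r \<in> {0..<q ^ 2}" "r' \<in> {0..<q ^ 2}" and "?A r c = ?A r' c"
      then have "a1 * (t (r div q) - t (r' div q)) + a2 * (t (r mod q) - t (r' mod q)) \<in> I"
        and "b1 * (t (r div q) - t (r' div q)) + b2 * (t (r mod q) - t (r' mod q)) \<in> I"
        by (auto dest: pair_symbol_eqD simp: lin_diff)
      from cramer_mem[OF this col] show "r = r'" using r by (auto intro: index_eqI)
    qed
  qed (auto simp: pair_symbol_less)
next
  fix a b assume ab: "a < q" "b < q"
  show "bij_betw (\<lambda>(r, c). ?A (a * q + r) (b * q + c)) ({0..<q} \<times> {0..<q}) {0..<q ^ 2}"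
  proof (rule bij_betw_of_inj_on_card)
    show "inj_on (\<lambda>(r, c). ?A (a * q + r) (b * q + c)) ({0..<q} \<times> {0..<q})"
    proof (rule inj_onI, clarify)
      fix r c r' c' assume rc: "r \<in> {0..<q}" "c \<in> {0..<q}" "r' \<in> {0..<q}" "c' \<in> {0..<q}"
        and "?A (a * q + r) (b * q + c) = ?A (a * q + r') (b * q + c')"
      then have "a2 * (t r - t r') + a4 * (t c - t c') \<in> I"
        and "b2 * (t r - t r') + b4 * (t c - t c') \<in> I"
        by (auto dest: pair_symbol_eqD simp: lin_diff cell_div_mod)
      from cramer_mem[OF this sub] show "r = r' \<and> c = c'" using rc by (auto intro: t_inj)
    qed
  qed (use pair_symbol_less in \<open>auto simp: power2_eq_square\<close>)
qed

lemma subsquares_latin_lin: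
  assumes "a2 \<notin> I" and "a4 \<notin> I"
  shows "subsquares_latin q (\<lambda>r c. code (lin a1 a2 a3 a4 r c))" (is "subsquares_latin q ?A")
  unfolding subsquares_latin_def
proof (intro allI impI conjI)
  fix a b r assume "a < q" "b < q" "r < q"
  show "bij_betw (\<lambda>c. ?A (a * q + r) (b * q + c)) {0..<q} {0..<q}"
    using code_less cancel_mem[OF _ assms(2)]
    by (intro bij_betw_of_inj_on_card inj_onI)
       (auto dest!: code_eqD simp: lin_diff cell_div_mod intro: t_inj)
next
  fix a b c assume "a < q" "b < q" "c < q"
  show "bij_betw (\<lambda>r. ?A (a * q + r) (b * q + c)) {0..<q} {0..<q}"
    using code_less cancel_mem[OF _ assms(1)]
    by (intro bij_betw_of_inj_on_card inj_onI)
       (auto dest!: code_eqD simp: lin_diff cell_div_mod intro: t_inj)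
qed

text \<open>The value at \<open>l\<close> of \<open>x1 + x2 Y + x4 Y^2 + x3 Y^3\<close>. The large
  row index takes the constant term and the large column index the top term, so fixing either one
  reduces differences to quadratics, in the first case after dividing by \<open>Y\<close>.\<close>

definition cubic :: "'a \<Rightarrow> nat \<Rightarrow> nat \<Rightarrow> 'a" where
  "cubic l = lin 1 l (l ^ 3) (l ^ 2)"

definition cubic_deriv :: "'a \<Rightarrow> nat \<Rightarrow> nat \<Rightarrow> 'a" where
  "cubic_deriv l = lin 0 1 (3 * l ^ 2) (2 * l)"

definition tangent_array :: "'a \<Rightarrow> array" where
  "tangent_array l = (\<lambda>r c. pair_symbol (cubic l r c) (cubic_deriv l r c))"

lemma radix_tangent_array: "radix q (tangent_array l) = (\<lambda>r c. code (cubic l r c))"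
  by (simp add: radix_def tangent_array_def)

text \<open>The minors are \<open>- (l ^ 4)\<close>, \<open>1\<close> and \<open>l ^ 2\<close>; the
  factors 2 and 3 of the derivative cancel, so every characteristic is covered.\<close>

lemma sudoku_tangent_array:
  assumes "l \<notin> I"
  shows "sudoku q (tangent_array l)"
  unfolding tangent_array_def cubic_def cubic_deriv_def
proof (rule sudoku_lin)
  have "l ^ 3 * (2 * l) - l ^ 2 * (3 * l ^ 2) = - (l ^ 4)"
    by (simp add: algebra_simps power2_eq_square power3_eq_cube power4_eq_xxxx)
  then show "l ^ 3 * (2 * l) - l ^ 2 * (3 * l ^ 2) \<notin> I"
    using assms power_mem[of l 4] uminus_mem[of "- (l ^ 4)"] by auto
  show "1 * 1 - l * 0 \<notin> I" using one_notin by simp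
  have "l * (2 * l) - l ^ 2 * 1 = l ^ 2" by (simp add: algebra_simps power2_eq_square)
  then show "l * (2 * l) - l ^ 2 * 1 \<notin> I" using assms power_mem[of l 2] by auto
qed

text \<open>Both digits are now values, at \<open>l\<close> and at \<open>m\<close>, and each minor
  is \<open>l - m\<close> times a monomial in \<open>l\<close> and \<open>m\<close>, up to
  sign.\<close>

lemma sudoku_composite_tangent_array:
  assumes "l \<notin> I" and "m \<notin> I" and "l - m \<notin> I"
  shows "sudoku q (composite q (tangent_array l) (tangent_array m))"
proof -
  have "composite q (tangent_array l) (tangent_array m) = (\<lambda>r c. pair_symbol (cubic l r c) (cubic m r c))"
    by (simp add: composite_def radix_tangent_array pair_symbol_def)
  moreover have "sudoku q (\<lambda>r c. pair_symbol (cubic l r c) (cubic m r c))"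
    unfolding cubic_def
  proof (rule sudoku_lin)
    have "l ^ 3 * m ^ 2 - l ^ 2 * m ^ 3 = l ^ 2 * (m ^ 2 * (l - m))"
      by (simp add: algebra_simps power2_eq_square power3_eq_cube)
    then show "l ^ 3 * m ^ 2 - l ^ 2 * m ^ 3 \<notin> I" using assms prime_mem power_mem by metis
    have "1 * m - l * 1 = - (l - m)" by simp
    then show "1 * m - l * 1 \<notin> I" using assms(3) uminus_mem[of "- (l - m)"] by auto
    have "l * m ^ 2 - l ^ 2 * m = - (l * (m * (l - m)))" by (simp add: algebra_simps power2_eq_square)
    then show "l * m ^ 2 - l ^ 2 * m \<notin> I"
      using assms prime_mem uminus_mem[of "- (l * (m * (l - m)))"] by auto
  qed
  ultimately show ?thesis by simp
qed

text \<open>Cells with equal symbol pairs differ by a cubic that has double zeros at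
  \<open>l\<close> and \<open>m\<close> modulo \<open>I\<close>.\<close>

lemma orth_tangent_array:
  assumes "l - m \<notin> I"
  shows "orth (grid q) {0..<q ^ 2} {0..<q ^ 2} (tangent_array l) (tangent_array m)"
  unfolding orth_def
proof (rule bij_betw_of_inj_on_card)
  show "inj_on (\<lambda>(r, c). (tangent_array l r c, tangent_array m r c)) (grid q)"
  proof (rule inj_onI, clarify)
    fix r c r' c' assume rc: "(r, c) \<in> grid q" "(r', c') \<in> grid q"
      and "tangent_array l r c = tangent_array l r' c'" "tangent_array m r c = tangent_array m r' c'"
    then have mem: "cubic l r c - cubic l r' c' \<in> I" "cubic m r c - cubic m r' c' \<in> I"
      "cubic_deriv l r c - cubic_deriv l r' c' \<in> I" "cubic_deriv m r c - cubic_deriv m r' c' \<in> I"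
      unfolding tangent_array_def by (auto dest: pair_symbol_eqD)
    let ?a = "t (r div q) - t (r' div q)" and ?b = "t (r mod q) - t (r' mod q)"
    let ?c = "t (c mod q) - t (c' mod q)" and ?d = "t (c div q) - t (c' div q)"
    have "?a + l * ?b + l ^ 2 * ?c + l ^ 3 * ?d \<in> I" "?a + m * ?b + m ^ 2 * ?c + m ^ 3 * ?d \<in> I"
      "?b + 2 * l * ?c + 3 * l ^ 2 * ?d \<in> I" "?b + 2 * m * ?c + 3 * m ^ 2 * ?d \<in> I"
      using mem by (simp_all add: cubic_def cubic_deriv_def lin_diff add.assoc add.commute add.left_commute)
    from hermite_cubic[OF assms this] show "r = r' \<and> c = c'"
      using rc by (auto simp: grid_def intro: index_eqI)
  qed
qed (auto simp: grid_def tangent_array_def pair_symbol_less)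

text \<open>In a large row the difference of two cells has no constant term, so it is
  \<open>Y\<close> times a quadratic. As \<open>l\<close> and \<open>m\<close> are nonzero modulo
  \<open>I\<close>, this quadratic inherits the zero at \<open>l\<close> and the double zero at
  \<open>m\<close>.\<close>

lemma orth_large_row_tangent_array:
  assumes "l \<notin> I" and "m \<notin> I" and "l - m \<notin> I" and x: "x < q"
  shows "orth (large_row q x) {0..<q} {0..<q ^ 2} (radix q (tangent_array l)) (tangent_array m)"
  unfolding orth_def radix_tangent_array
proof (rule bij_betw_of_inj_on_card)
  show "inj_on (\<lambda>(r, c). (code (cubic l r c), tangent_array m r c)) (large_row q x)"
  proof (rule inj_onI, clarify)
    fix r c r' c' assume rc: "(r, c) \<in> large_row q x" "(r', c') \<in> large_row q x"
      and "code (cubic l r c) = code (cubic l r' c')" "tangent_array m r c = tangent_array m r' c'"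
    then have mem: "cubic l r c - cubic l r' c' \<in> I" "cubic m r c - cubic m r' c' \<in> I"
      "cubic_deriv m r c - cubic_deriv m r' c' \<in> I"
      unfolding tangent_array_def by (auto dest: pair_symbol_eqD code_eqD)
    have div: "r div q = x" "r' div q = x"
      using rc x by (auto simp: large_row_def intro!: div_nat_eqI simp: mult.commute)
    let ?b = "t (r mod q) - t (r' mod q)"
    let ?c = "t (c mod q) - t (c' mod q)" and ?d = "t (c div q) - t (c' div q)"
    have "l * (?b + l * ?c + l ^ 2 * ?d) \<in> I" "m * (?b + m * ?c + m ^ 2 * ?d) \<in> I"
      using mem by (simp_all add: cubic_def lin_diff div algebra_simps power2_eq_square power3_eq_cube)
    then have p: "?b + l * ?c + l ^ 2 * ?d \<in> I" "?b + m * ?c + m ^ 2 * ?d \<in> I"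
      using assms cancel_mem by blast+
    have "?b + 2 * m * ?c + 3 * m ^ 2 * ?d \<in> I"
      using mem by (simp add: cubic_deriv_def lin_diff add.assoc add.commute add.left_commute)
    \<comment> \<open>Product rule: the derivative of \<open>Y g\<close> at \<open>m\<close> minus
      \<open>g(m)\<close> is \<open>m g'(m)\<close>.\<close>
    from diff_mem[OF this p(2)] have "m * (?c + 2 * m * ?d) \<in> I"
      by (simp add: algebra_simps power2_eq_square)
    then have "?c + 2 * m * ?d \<in> I" using assms cancel_mem by blast
    from hermite_quadratic[OF assms(3) p this] show "r = r' \<and> c = c'"
      using rc x by (auto simp: large_row_def div zero_mem intro!: index_eqI block_less_square)
  qed
qed (auto simp: large_row_def tangent_array_def pair_symbol_less code_less)

text \<open>In a large column the top coefficients agree, so the difference is itself a quadratic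
  with a zero at \<open>l\<close> and a double zero at \<open>m\<close>.\<close>

lemma orth_large_col_tangent_array:
  assumes "l - m \<notin> I" and x: "x < q"
  shows "orth (large_col q x) {0..<q} {0..<q ^ 2} (radix q (tangent_array l)) (tangent_array m)"
  unfolding orth_def radix_tangent_array
proof (rule bij_betw_of_inj_on_card)
  show "inj_on (\<lambda>(r, c). (code (cubic l r c), tangent_array m r c)) (large_col q x)"
  proof (rule inj_onI, clarify)
    fix r c r' c' assume rc: "(r, c) \<in> large_col q x" "(r', c') \<in> large_col q x"
      and "code (cubic l r c) = code (cubic l r' c')" "tangent_array m r c = tangent_array m r' c'"
    then have mem: "cubic l r c - cubic l r' c' \<in> I" "cubic m r c - cubic m r' c' \<in> I"
      "cubic_deriv m r c - cubic_deriv m r' c' \<in> I"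
      unfolding tangent_array_def by (auto dest: pair_symbol_eqD code_eqD)
    have div: "c div q = x" "c' div q = x"
      using rc x by (auto simp: large_col_def intro!: div_nat_eqI simp: mult.commute)
    let ?a = "t (r div q) - t (r' div q)" and ?b = "t (r mod q) - t (r' mod q)"
    let ?c = "t (c mod q) - t (c' mod q)"
    have "?a + l * ?b + l ^ 2 * ?c \<in> I" "?a + m * ?b + m ^ 2 * ?c \<in> I" "?b + 2 * m * ?c \<in> I"
      using mem by (simp_all add: cubic_def cubic_deriv_def lin_diff div)
    from hermite_quadratic[OF assms(1) this] show "r = r' \<and> c = c'"
      using rc x by (auto simp: large_col_def div zero_mem intro!: index_eqI block_less_square)
  qed
qed (auto simp: large_col_def tangent_array_def pair_symbol_less code_less)

text \<open>\<open>Suc i\<close> skips \<open>t 0 = 0\<close>, so the parameters run through the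
  \<open>q - 1\<close> nonzero residue classes.\<close>

theorem substrongly_orthogonal_tangent_arrays:
  "substrongly_orthogonal q (q - 1) (\<lambda>i. tangent_array (t (Suc i)))"
proof -
  have nz: "t (Suc i) \<notin> I" if "i < q - 1" for i
  proof -
    have "Suc i < q" using that by linarith
    then show ?thesis using t_inj[of "Suc i" 0] by (auto simp: t_0)
  qed
  have ne: "t (Suc i) - t (Suc j) \<notin> I" if "i < q - 1" "j < q - 1" "i \<noteq> j" for i j
  proof -
    have "Suc i < q" "Suc j < q" using that by linarith+
    then show ?thesis using t_inj[of "Suc i" "Suc j"] that(3) by auto
  qed
  have "subsquares_latin q (radix q (tangent_array (t (Suc i))))" if "i < q - 1" for i
    unfolding radix_tangent_array cubic_def
    using nz[OF that] power_mem by (intro subsquares_latin_lin) blast+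
  then show ?thesis
    unfolding substrongly_orthogonal_def mutually_orthogonal_sudoku_def
    using nz ne by (auto intro!: sudoku_tangent_array orth_tangent_array sudoku_composite_tangent_array
        orth_large_row_tangent_array orth_large_col_tangent_array)
qed

end

section \<open>The upper bound\<close>

theorem substrongly_orthogonal_le:
  assumes q: "q \<ge> 2" and M: "substrongly_orthogonal q m M"
  shows "m \<le> q - 1"
proof -
  define R where "R i = radix q (M i)" for i
  have latin: "bij_betw (\<lambda>c. R i r c) {0..<q} {0..<q}" "bij_betw (\<lambda>r. R i r c) {0..<q} {0..<q}"
    if "i < m" "r < q" "c < q" for i r c
  proof -
    have "subsquares_latin q (R i)" using M that by (simp add: substrongly_orthogonal_def R_def)
    from this[unfolded subsquares_latin_def, rule_format, of 0 0] that
    show "bij_betw (\<lambda>c. R i r c) {0..<q} {0..<q}" "bij_betw (\<lambda>r. R i r c) {0..<q} {0..<q}"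
      by auto
  qed
  \<comment> \<open>A symbol of the composite encodes the pair of radix entries, so its top left
    subsquare being filled without repetition means that the pair determines the cell.\<close>
  have orth: "(r, c) = (r', c')"
    if "i < m" "j < m" "i \<noteq> j" "r < q" "c < q" "r' < q" "c' < q" "R i r c = R i r' c'" "R j r c = R j r' c'"
    for i j r c r' c'
  proof -
    let ?N = "composite q (M i) (M j)"
    have "sudoku q ?N" using M that by (simp add: substrongly_orthogonal_def)
    then have "\<forall>a<q. \<forall>b<q. bij_betw (\<lambda>(r, c). ?N (a * q + r) (b * q + c)) ({0..<q} \<times> {0..<q}) {0..<q ^ 2}"
      by (simp add: sudoku_def)
    from this[rule_format, of 0 0]
    have inj: "inj_on (\<lambda>(r, c). ?N r c) ({0..<q} \<times> {0..<q})"
      using q by (simp add: bij_betw_imp_inj_on)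
    show ?thesis
      by (rule inj_onD[OF inj]) (use that in \<open>auto simp: composite_def R_def\<close>)
  qed
  have "\<exists>c. c < q \<and> R i 0 c = R i 1 0" if "i < m" for i
  proof -
    \<comment> \<open>\<open>q \<ge> 2\<close> puts the cell (1, 0) inside the top left
      subsquare.\<close>
    have "R i 1 0 \<in> {0..<q}" using bij_betwE[OF latin(1)[OF that, of 1 0]] q by simp
    also have "{0..<q} = R i 0 ` {0..<q}" using latin(1)[OF that, of 0 0] q by (simp add: bij_betw_def)
    finally show ?thesis by auto
  qed
  then obtain c where c: "\<And>i. i < m \<Longrightarrow> c i < q \<and> R i 0 (c i) = R i 1 0" by metis
  have "c i \<noteq> 0" if "i < m" for i
  proof
    assume "c i = 0"
    then have "R i 0 0 = R i 1 0" using c[OF that] by simp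
    then show False using bij_betw_imp_inj_on[OF latin(2)[OF that, of 0 0]] q by (auto dest: inj_onD)
  qed
  then have "c ` {..<m} \<subseteq> {1..<q}" using c by fastforce
  moreover have "inj_on c {..<m}"
  proof (rule inj_onI, rule ccontr)
    fix i j assume ij: "i \<in> {..<m}" "j \<in> {..<m}" "c i = c j" "i \<noteq> j"
    \<comment> \<open>Both arrays repeat their entry of the cell (1, 0) in the common cell
      \<open>(0, c i)\<close>, so orthogonality would identify the two cells.\<close>
    have "(0 :: nat, c i) = (1, 0)"
      by (rule orth[of i j]) (use ij c[of i] c[of j] q in auto)
    then show False by simp
  qed
  ultimately have "card {..<m} \<le> card {1..<q}" by (intro card_inj_on_le[of c]) auto
  then show ?thesis by simp
qed

theorem theorem5p2:
  fixes q :: nat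
  assumes "primepow q"
  shows "(\<forall>m M. substrongly_orthogonal q m M \<longrightarrow> m \<le> q - 1) \<and>
         (\<exists>M. substrongly_orthogonal q (q - 1) M)"
proof (intro conjI allI impI)
  show "m \<le> q - 1" if "substrongly_orthogonal q m M" for m M
    using substrongly_orthogonal_le[OF _ that] primepow_gt_Suc_0[OF assms] by simp
  obtain I :: "int poly set" and t where I: "prime_ring_ideal I" and t: "t 0 = 0"
    "\<And>x. \<exists>k<q. x - t k \<in> I" "\<And>j k. j < q \<Longrightarrow> k < q \<Longrightarrow> t j - t k \<in> I \<Longrightarrow> j = k"
    using exists_residue_field[OF assms] by metis
  interpret prime_ring_ideal I by (rule I)
  interpret coded_residue_field I q t by unfold_locales (use t in auto)
  show "\<exists>M. substrongly_orthogonal q (q - 1) M"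
    using substrongly_orthogonal_tangent_arrays by blast
qed

end
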